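(* Let $\mathcal Q$ be a finite set, let $p(q)\in(0,1]$ ($q\in\mathcal Q$) with $\sum_{q\in\mathcal Q}p(q)=1$, let $c(q)\in(0,1]$ ($q\in\mathcal Q$), and let $d:\mathcal Q\times\mathcal Q\to\mathbb R_+$ be a distance function. For $\mathcal M\subseteq\mathcal Q$ put $$\ell(\mathcal M;\boldsymbol p,\boldsymbol c,d)=\sum_{q\in\mathcal Q}p(q)\min\{c(q),d(q,\mathcal M)\},\qquad d(q,\mathcal M)=\min_{u\in\mathcal M}d(q,u).$$ Then $\ell(\cdot\,;\boldsymbol p,\boldsymbol c,d)$ is non-increasing and supermodular as a set function; that is, for all $\mathcal A\subseteq\mathcal B\subseteq\mathcal Q$ and $q\in\mathcal Q\setminus\mathcal B$: (i) $\ell(\mathcal B;\boldsymbol p,\boldsymbol c,d)\le\ell(\mathcal A;\boldsymbol p,\boldsymbol c,d)$; and (ii) $\ell(\mathcal A\cup\{q\};\boldsymbol p,\boldsymbol c,d)-\ell(\mathcal A;\boldsymbol p,\boldsymbol c,d)\le\ell(\mathcal B\cup\{q\};\boldsymbol p,\boldsymbol c,d)-\ell(\mathcal B;\boldsymbol p,\boldsymbol c,d)$.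
   Context: $\boldsymbol p=(p(q))_{q\in\mathcal Q}$ and $\boldsymbol c=(c(q))_{q\in\mathcal Q}$ are the arrival probabilities and serving costs of the queries. For the empty set, $d(q,\emptyset)=+\infty$, so $\min\{c(q),d(q,\emptyset)\}=c(q)$. *)

theory Defs
  imports Complex_Main "HOL-Library.Extended_Real"
begin

text \<open>Distance from a query to a finite set of queries; the distance to the empty set
  is \<open>\<infinity>\<close>, which is why values are taken in \<^typ>\<open>ereal\<close>.\<close>

definition dist_to_set :: "('q \<Rightarrow> 'q \<Rightarrow> real) \<Rightarrow> 'q \<Rightarrow> 'q set \<Rightarrow> ereal" where
  "dist_to_set d q M = (if M = {} then \<infinity> else ereal (Min (d q ` M)))"

text \<open>The minimum below is always a finite value, being bounded by \<open>c q\<close>, so that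
  \<^const>\<open>real_of_ereal\<close> merely changes its type.\<close>

definition loss ::
  "'q set \<Rightarrow> ('q \<Rightarrow> real) \<Rightarrow> ('q \<Rightarrow> real) \<Rightarrow> ('q \<Rightarrow> 'q \<Rightarrow> real) \<Rightarrow> 'q set \<Rightarrow> real" where
  "loss Q p c d M = (\<Sum>q\<in>Q. p q * real_of_ereal (min (ereal (c q)) (dist_to_set d q M)))"

end

theory Submission
  imports Defs
begin

text \<open>The loss is a sum with nonnegative weights, so both claims can be checked separately for
  each query \<open>x\<close>. The cost \<open>c x\<close> acts as the distance to one extra point
  that is always available. By \<open>loss_eq_Min\<close> the summand is then a minimum over a
  nonempty finite set of reals, and neither infinity nor the empty set needs separate treatment.
  Such a minimum can only drop as the set grows, which gives \<open>loss_antimono\<close>; combined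
  with diminishing returns for a single \<open>x\<close>, this gives
  \<open>loss_supermodular\<close>.\<close>

lemma loss_eq_Min:
  assumes "finite M"
  shows "loss Q p c d M = (\<Sum>x\<in>Q. p x * Min (insert (c x) (d x ` M)))"
proof -
  have "real_of_ereal (min (ereal (c x)) (dist_to_set d x M)) = Min (insert (c x) (d x ` M))" for x
    using assms by (cases "M = {}") (auto simp: dist_to_set_def min_def)
  then show ?thesis
    by (simp add: loss_def)
qed

lemma loss_antimono:
  assumes "A \<subseteq> B" "finite B" "\<And>x. x \<in> Q \<Longrightarrow> 0 \<le> p x"
  shows "loss Q p c d B \<le> loss Q p c d A"
proof -
  have "Min (insert (c x) (d x ` B)) \<le> Min (insert (c x) (d x ` A))" for x
    using assms by (intro Min_antimono) auto
  then show ?thesis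
    using assms finite_subset[OF assms(1,2)]
    by (auto simp: loss_eq_Min intro!: sum_mono mult_left_mono)
qed

text \<open>If the best value available to \<open>x\<close> is s, adding \<open>u\<close> saves
  max(0, s - \<open>d x u\<close>). The smaller set \<open>A\<close> leaves \<open>x\<close> with
  the larger s, so \<open>u\<close> saves at least as much there as over \<open>B\<close>.\<close>

lemma loss_supermodular:
  assumes "A \<subseteq> B" "finite B" "\<And>x. x \<in> Q \<Longrightarrow> 0 \<le> p x"
  shows "loss Q p c d (insert u A) - loss Q p c d A \<le> loss Q p c d (insert u B) - loss Q p c d B"
proof -
  have "finite A"
    using assms finite_subset by blast
  define m where "m M x = Min (insert (c x) (d x ` M))" for M x
  \<comment> \<open>Moving \<open>d x u\<close> outermost leaves a set that still contains
    \<open>c x\<close>, so \<open>Min\<close> splits even when \<open>M\<close> is empty.\<close>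
  have insert: "m (insert u M) x = min (d x u) (m M x)" if "finite M" for M x
    using that by (simp add: m_def insert_commute[of "c x"])
  have "m B x \<le> m A x" for x
    unfolding m_def using assms by (intro Min_antimono) auto
  \<comment> \<open>The function \<open>s \<mapsto> min t s - s\<close> is non-increasing.\<close>
  then have "m (insert u A) x - m A x \<le> m (insert u B) x - m B x" for x
    using \<open>finite A\<close> \<open>finite B\<close> by (simp add: insert min_def) (smt (verit))
  then have "p x * (m (insert u A) x - m A x) \<le> p x * (m (insert u B) x - m B x)" if "x \<in> Q" for x
    using assms(3)[OF that] by (rule mult_left_mono)
  then have "(\<Sum>x\<in>Q. p x * (m (insert u A) x - m A x)) \<le> (\<Sum>x\<in>Q. p x * (m (insert u B) x - m B x))"
    by (rule sum_mono)
  moreover have "loss Q p c d M = (\<Sum>x\<in>Q. p x * m M x)" if "finite M" for M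
    using that by (simp add: loss_eq_Min m_def)
  ultimately show ?thesis
    using \<open>finite A\<close> \<open>finite B\<close> by (simp add: right_diff_distrib sum_subtractf)
qed

theorem lemma2:
  fixes Q :: "'q set"
    and p c :: "'q \<Rightarrow> real"
    and d :: "'q \<Rightarrow> 'q \<Rightarrow> real"
  assumes "finite Q"
    and "\<And>q. q \<in> Q \<Longrightarrow> 0 < p q \<and> p q \<le> 1"
    and "(\<Sum>q\<in>Q. p q) = 1"
    and "\<And>q. q \<in> Q \<Longrightarrow> 0 < c q \<and> c q \<le> 1"
    and "\<And>q u. q \<in> Q \<Longrightarrow> u \<in> Q \<Longrightarrow> 0 \<le> d q u"
  shows "(\<forall>A B. A \<subseteq> B \<and> B \<subseteq> Q \<longrightarrow> loss Q p c d B \<le> loss Q p c d A) \<and>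
    (\<forall>A B q. A \<subseteq> B \<and> B \<subseteq> Q \<and> q \<in> Q - B \<longrightarrow>
      loss Q p c d (A \<union> {q}) - loss Q p c d A \<le> loss Q p c d (B \<union> {q}) - loss Q p c d B)"
proof (intro conjI allI impI; elim conjE)
  fix A B :: "'q set"
  assume AB: "A \<subseteq> B" "B \<subseteq> Q"
  then have B: "finite B"
    using assms(1) finite_subset by blast
  have p: "0 \<le> p x" if "x \<in> Q" for x
    using assms(2)[OF that] by simp
  show "loss Q p c d B \<le> loss Q p c d A"
    using AB(1) B p by (rule loss_antimono)
  show "loss Q p c d (A \<union> {q}) - loss Q p c d A \<le> loss Q p c d (B \<union> {q}) - loss Q p c d B" for q
    using loss_supermodular[OF AB(1) B p] by simp
qed

end
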